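(* If $n\ge3$, then $$b(n,m)=\sum_{i=2}^{n-m}\left(\binom{i+m-1}{m}-1\right)a(n-i,m),\qquad 1\le m\le n-2,$$ with $b(n,0)=1$ if $n\ge1$ and $b(n,n-1)=0$ if $n\ge2$.
   Context: For a positive integer $n$, $\mathcal{L}_n$ denotes the set of all words $a=(a_1,a_2,\ldots,a_n)$ over the alphabet of non-negative integers satisfying: (i) $a_{i+1}\ge a_i-1$ for $1\le i<n$; and (ii) if $a_i=k>0$ with $i$ minimal (i.e. $i$ is the position of the left-most occurrence of the letter $k$), then there exist $i_1<i<i_2$ such that $a_{i_1}=a_{i_2}=k-1$. For $1\le m\le n$, $a(n,m)$ is the number of words in $\mathcal{L}_n$ containing exactly $m$ zeros. For $m\ge0$, $b(n,m)$ is the number of words in $\mathcal{L}_n$ containing exactly $m$ ones. *)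

theory Defs
  imports Main
begin

(* A word (a_1, ..., a_n) is a list w of length n, with a_i = w ! (i - 1).
   "leftmost w i" says that position i is the left-most occurrence in w of its letter. *)

definition leftmost :: "nat list \<Rightarrow> nat \<Rightarrow> bool" where
  "leftmost w i \<longleftrightarrow> i < length w \<and> (\<forall>j<i. w ! j \<noteq> w ! i)"

(* The inequality a_{i+1} >= a_i - 1 is written without subtraction. *)

definition LL :: "nat \<Rightarrow> nat list set" where
  "LL n = {w. length w = n \<and>
     (\<forall>i. Suc i < n \<longrightarrow> w ! i \<le> w ! Suc i + 1) \<and>
     (\<forall>i k. leftmost w i \<and> w ! i = k \<and> k > 0 \<longrightarrow>
        (\<exists>i1 i2. i1 < i \<and> i < i2 \<and> i2 < n \<and> w ! i1 = k - 1 \<and> w ! i2 = k - 1))}"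

(* LL n is finite: by the second condition, the letters of w form an initial segment
   of the naturals, so they are smaller than n. Hence card counts as intended below. *)

definition a :: "nat \<Rightarrow> nat \<Rightarrow> nat" where
  "a n m = card {w \<in> LL n. count_list w 0 = m}"

definition b :: "nat \<Rightarrow> nat \<Rightarrow> nat" where
  "b n m = card {w \<in> LL n. count_list w 1 = m}"

end

theory Submission
  imports Defs
begin

text \<open>
  Delete all zeros of a word of \<open>LL n\<close> and decrement the remaining letters. The result is again a
  word of the same kind, and the ones of the original word become its zeros. So the words of
  \<open>LL n\<close> with \<open>m\<close> ones and \<open>i\<close> zeros are sorted into fibres over the words
  \<open>v \<in> LL (n - i)\<close> with \<open>m\<close> zeros, and it suffices to see that for \<open>m \<ge> 1\<close> and \<open>i \<ge> 1\<close> each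
  fibre has \<open>((i + m - 1) choose m) - 1\<close> elements.

  To rebuild a word from \<open>v\<close>, increment its letters and insert \<open>i\<close> zeros. Since a letter drops by
  at most one from each position to the next, a zero can only be placed at the very front, behind a
  one, or behind another zero; this leaves \<open>m + 1\<close> gaps, so there are \<open>(j + m) choose j\<close> ways of
  inserting \<open>j\<close> zeros (\<open>card_insertions\<close>). The condition on leftmost occurrences is inherited from
  \<open>v\<close> for all letters except one. For the letter one it asks for a zero in front of the first one
  and a zero behind it. As \<open>v\<close> starts with a zero, the incremented word starts with a one, so the
  front gap must receive a zero, and the other \<open>i - 1\<close> zeros can be inserted in any way that does
  not put all of them into the front gap as well (\<open>fibre_eq\<close>): one insertion out of
  \<open>(i - 1 + m) choose m\<close> is excluded.

  For \<open>m = n - 1\<close> the same formula gives an empty sum. For \<open>m = 0\<close>, a word without ones consists of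
  zeros only, because its letters form an initial segment of the natural numbers.
\<close>

section \<open>The two conditions on words, in terms of list decompositions\<close>

abbreviation drops_at_most_one :: "nat list \<Rightarrow> bool" where
  "drops_at_most_one \<equiv> successively (\<lambda>x y. x \<le> y + 1)"

text \<open>Decompositions, unlike positions, survive the deletion of letters.\<close>

definition flanked :: "nat list \<Rightarrow> bool" where
  "flanked w \<longleftrightarrow> (\<forall>xs k ys. w = xs @ Suc k # ys \<and> Suc k \<notin> set xs \<longrightarrow> k \<in> set xs \<and> k \<in> set ys)"

lemma flankedD:
  assumes "flanked w" "w = xs @ Suc k # ys" "Suc k \<notin> set xs"
  shows "k \<in> set xs" "k \<in> set ys"
  using assms unfolding flanked_def by blast+

lemma flanked_iff_leftmost:
  "flanked w \<longleftrightarrow> (\<forall>i k. leftmost w i \<and> w ! i = k \<and> k > 0 \<longrightarrow>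
     (\<exists>i1 i2. i1 < i \<and> i < i2 \<and> i2 < length w \<and> w ! i1 = k - 1 \<and> w ! i2 = k - 1))"
  (is "_ \<longleftrightarrow> ?R")
proof
  assume fl: "flanked w"
  show ?R
  proof (intro allI impI, elim conjE)
    fix i k
    assume lm: "leftmost w i" and wi: "w ! i = k" and k: "k > 0"
    have i: "i < length w" and fresh: "\<forall>j<i. w ! j \<noteq> k"
      using lm wi by (auto simp: leftmost_def)
    have dec: "w = take i w @ Suc (k - 1) # drop (Suc i) w"
      using id_take_nth_drop[OF i] wi k by simp
    have "Suc (k - 1) \<notin> set (take i w)"
      using fresh i k by (auto simp: in_set_conv_nth)
    from flankedD[OF fl dec this]
    have before: "k - 1 \<in> set (take i w)" and after: "k - 1 \<in> set (drop (Suc i) w)" .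
    from before obtain i1 where i1: "i1 < i" "w ! i1 = k - 1"
      using i by (auto simp: in_set_conv_nth)
    from after obtain d where d: "d < length w - Suc i" "w ! (Suc i + d) = k - 1"
      using i by (auto simp: in_set_conv_nth)
    show "\<exists>i1 i2. i1 < i \<and> i < i2 \<and> i2 < length w \<and> w ! i1 = k - 1 \<and> w ! i2 = k - 1"
      using i1 d by (intro exI[of _ i1] exI[of _ "Suc i + d"]) auto
  qed
next
  assume R: ?R
  show "flanked w"
    unfolding flanked_def
  proof (intro allI impI, elim conjE)
    fix xs k ys
    assume w: "w = xs @ Suc k # ys" and fresh: "Suc k \<notin> set xs"
    have "leftmost w (length xs)"
      using fresh by (auto simp: leftmost_def w nth_append dest: nth_mem)
    moreover have "w ! length xs = Suc k"
      by (simp add: w)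
    ultimately have "\<exists>i1 i2. i1 < length xs \<and> length xs < i2 \<and> i2 < length w \<and>
        w ! i1 = Suc k - 1 \<and> w ! i2 = Suc k - 1"
      using R by blast
    then obtain i1 i2 where i: "i1 < length xs" "length xs < i2" "i2 < length w"
      and eq: "w ! i1 = k" "w ! i2 = k"
      by auto
    have "k \<in> set xs"
      using i(1) eq(1) by (auto simp: w nth_append)
    moreover have "i2 - length xs - 1 < length ys" "ys ! (i2 - length xs - 1) = k"
      using i eq(2) by (auto simp: w nth_append nth_Cons')
    ultimately show "k \<in> set xs \<and> k \<in> set ys"
      by (auto simp: in_set_conv_nth)
  qed
qed

lemma in_LL_iff: "w \<in> LL n \<longleftrightarrow> length w = n \<and> drops_at_most_one w \<and> flanked w"
  unfolding LL_def flanked_iff_leftmost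
  by (auto simp: successively_conv_nth)

lemma flanked_start:
  assumes "flanked w" "w \<noteq> []"
  obtains w' where "w = 0 # w'"
proof (cases w)
  case Nil
  with assms show ?thesis by simp
next
  case (Cons x w')
  have "x = 0"
  proof (rule ccontr)
    assume "x \<noteq> 0"
    then have "w = [] @ Suc (x - 1) # w'" using Cons by simp
    from flankedD(1)[OF assms(1) this] show False by simp
  qed
  with Cons that show ?thesis by simp
qed

text \<open>The first occurrence of a positive letter is preceded by its predecessor, so the letters form
  an initial segment of the natural numbers.\<close>

lemma flanked_letters_downward_closed:
  assumes "flanked w" "k \<in> set w" "j \<le> k"
  shows "j \<in> set w"
  using assms(3,2)
proof (induction k rule: dec_induct)
  case base
  then show ?case .
next
  case (step k)
  obtain xs ys where "w = xs @ Suc k # ys" "Suc k \<notin> set xs"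
    using split_list_first[OF step.prems] by blast
  then show ?case
    using flankedD(1)[OF assms(1)] step.IH by auto
qed

lemma flanked_letter_less_length:
  assumes "flanked w" "k \<in> set w"
  shows "k < length w"
proof -
  have "{..k} \<subseteq> set w"
    using flanked_letters_downward_closed[OF assms] by auto
  then have "card {..k} \<le> card (set w)"
    by (intro card_mono) auto
  also have "\<dots> \<le> length w"
    by (rule card_length)
  finally show ?thesis by simp
qed

lemma finite_LL: "finite (LL n)"
proof (rule finite_subset)
  show "LL n \<subseteq> {w. set w \<subseteq> {..<n} \<and> length w = n}"
    by (auto simp: in_LL_iff dest: flanked_letter_less_length)
  show "finite {w. set w \<subseteq> {..<n} \<and> length w = n}"
    by (rule finite_lists_length_eq) simp
qed

section \<open>Deleting the zeros\<close>

fun strip :: "nat list \<Rightarrow> nat list" where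
  "strip [] = []"
| "strip (0 # w) = strip w"
| "strip (Suc x # w) = x # strip w"

lemma strip_append [simp]: "strip (xs @ ys) = strip xs @ strip ys"
  by (induction xs rule: strip.induct) auto

lemma strip_replicate_0 [simp]: "strip (replicate j 0) = []"
  by (induction j) auto

lemma strip_map_Suc [simp]: "strip (map Suc v) = v"
  by (induction v) auto

lemma in_set_strip [simp]: "k \<in> set (strip w) \<longleftrightarrow> Suc k \<in> set w"
  by (induction w rule: strip.induct) auto

lemma count_strip_0: "count_list (strip w) 0 = count_list w 1"
  by (induction w rule: strip.induct) auto

lemma length_strip: "length (strip w) + count_list w 0 = length w"
  by (induction w rule: strip.induct) auto

lemma strip_eq_NilD: "strip w = [] \<Longrightarrow> w = replicate (count_list w 0) 0"
  by (induction w rule: strip.induct) auto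

lemma map_Suc_strip: "0 \<notin> set w \<Longrightarrow> map Suc (strip w) = w"
  by (induction w rule: strip.induct) auto

lemma strip_eq_appendD:
  assumes "strip w = xs @ k # ys"
  shows "\<exists>us vs. w = us @ Suc k # vs \<and> strip us = xs \<and> strip vs = ys"
  using assms
proof (induction w arbitrary: xs rule: strip.induct)
  case 1
  then show ?case by simp
next
  case (2 w)
  then obtain us vs where "w = us @ Suc k # vs \<and> strip us = xs \<and> strip vs = ys"
    by fastforce
  then show ?case
    by (intro exI[of _ "0 # us"] exI[of _ vs]) simp
next
  case (3 x w)
  show ?case
  proof (cases xs)
    case Nil
    with 3 show ?thesis
      by (intro exI[of _ "[]"] exI[of _ w]) simp
  next
    case (Cons z zs)
    with 3 obtain us vs where "w = us @ Suc k # vs \<and> strip us = zs \<and> strip vs = ys"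
      by fastforce
    with Cons 3 show ?thesis
      by (intro exI[of _ "Suc x # us"] exI[of _ vs]) simp
  qed
qed

text \<open>If zeros are deleted between two letters, then the left one was a one, since it was followed
  by a zero. It becomes a zero, from which there is nothing to drop.\<close>

lemma drops_at_most_one_strip:
  "drops_at_most_one w \<Longrightarrow> drops_at_most_one (strip w)"
proof (induction w rule: strip.induct)
  case (3 x w)
  have "x \<le> hd (strip w) + 1" if "strip w \<noteq> []"
  proof (cases w rule: strip.cases)
    case 1
    with that show ?thesis by simp
  next
    case (2 w')
    with 3 show ?thesis by simp
  next
    case (3 y w')
    with "3.prems" show ?thesis by simp
  qed
  with 3 show ?case by (auto simp: successively_Cons)
qed (auto simp: successively_Cons)

text \<open>Stripping translates the condition for the letter \<open>Suc (Suc k)\<close> into the condition for the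
  letter \<open>Suc k\<close>; what is lost is the condition for the letter one.\<close>

lemma flanked_iff_strip:
  "flanked w \<longleftrightarrow> flanked (strip w) \<and>
     (\<forall>us vs. w = us @ 1 # vs \<and> 1 \<notin> set us \<longrightarrow> 0 \<in> set us \<and> 0 \<in> set vs)"
  (is "_ \<longleftrightarrow> _ \<and> ?one")
proof (intro iffI conjI)
  assume fl: "flanked w"
  show "flanked (strip w)"
    unfolding flanked_def
  proof (intro allI impI, elim conjE)
    fix xs k ys
    assume "strip w = xs @ Suc k # ys" and fresh: "Suc k \<notin> set xs"
    then obtain us vs where w: "w = us @ Suc (Suc k) # vs" and s: "strip us = xs" "strip vs = ys"
      using strip_eq_appendD by blast
    have "Suc (Suc k) \<notin> set us"
      using fresh s by auto
    from flankedD[OF fl w this] show "k \<in> set xs \<and> k \<in> set ys"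
      by (simp add: s[symmetric])
  qed
  show ?one
    using flankedD[OF fl, where k = 0] by simp
next
  assume A: "flanked (strip w) \<and> ?one"
  show "flanked w"
    unfolding flanked_def
  proof (intro allI impI, elim conjE)
    fix us k vs
    assume w: "w = us @ Suc k # vs" and fresh: "Suc k \<notin> set us"
    show "k \<in> set us \<and> k \<in> set vs"
    proof (cases k)
      case 0
      with A w fresh show ?thesis by simp
    next
      case (Suc l)
      have "strip w = strip us @ Suc l # strip vs" and "Suc l \<notin> set (strip us)"
        using w fresh Suc by auto
      with A flankedD[of "strip w"] have "l \<in> set (strip us)" "l \<in> set (strip vs)"
        by blast+
      with Suc show ?thesis by simp
    qed
  qed
qed

section \<open>Counting the insertions of zeros\<close>

definition insertions :: "nat list \<Rightarrow> nat \<Rightarrow> nat list set" where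
  "insertions v j = {w. drops_at_most_one w \<and> strip w = v \<and> count_list w 0 = j}"

definition inner_insertions :: "nat list \<Rightarrow> nat \<Rightarrow> nat list set" where
  "inner_insertions v j = {w \<in> insertions v j. w = [] \<or> hd w \<noteq> 0}"

lemma finite_insertions: "finite (insertions v j)"
proof (rule finite_subset)
  show "insertions v j \<subseteq> {w. set w \<subseteq> insert 0 (Suc ` set v) \<and> length w = length v + j}"
  proof (intro subsetI CollectI conjI)
    fix w assume "w \<in> insertions v j"
    then have w: "strip w = v" "count_list w 0 = j"
      by (auto simp: insertions_def)
    show "x \<in> insert 0 (Suc ` set v)" if "x \<in> set w" for x
      using that in_set_strip[of "x - 1" w] w(1)
      by (cases "x = 0") (auto intro!: image_eqI[of x Suc "x - 1"])
    show "length w = length v + j"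
      using length_strip[of w] w by simp
  qed
  show "finite {w. set w \<subseteq> insert 0 (Suc ` set v) \<and> length w = length v + j}"
    by (rule finite_lists_length_eq) simp
qed

lemma insertions_0: "insertions v 0 = inner_insertions v 0"
proof -
  have "hd w \<noteq> 0" if "count_list w 0 = 0" "w \<noteq> []" for w :: "nat list"
    using that by (cases w) (auto split: if_splits)
  then show ?thesis
    unfolding inner_insertions_def insertions_def by blast
qed

lemma insertions_Suc:
  "insertions v (Suc j) = (#) 0 ` insertions v j \<union> inner_insertions v (Suc j)"
proof (intro equalityI subsetI)
  fix w assume w: "w \<in> insertions v (Suc j)"
  show "w \<in> (#) 0 ` insertions v j \<union> inner_insertions v (Suc j)"
  proof (cases "w = [] \<or> hd w \<noteq> 0")
    case True
    with w show ?thesis by (simp add: inner_insertions_def)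
  next
    case False
    then obtain w' where w': "w = 0 # w'"
      by (cases w) auto
    with w have "w' \<in> insertions v j"
      by (auto simp: insertions_def successively_Cons)
    with w' show ?thesis by simp
  qed
qed (auto simp: inner_insertions_def insertions_def successively_Cons)

lemma inner_insertions_Nil: "inner_insertions [] j = (if j = 0 then {[]} else {})"
proof -
  have "strip w = [] \<and> (w = [] \<or> hd w \<noteq> 0) \<longleftrightarrow> w = []" for w
    by (cases w rule: strip.cases) auto
  then have "w \<in> inner_insertions [] j \<longleftrightarrow> w = [] \<and> j = 0" for w
    by (cases "w = []") (auto simp: inner_insertions_def insertions_def)
  then have "inner_insertions [] j = {w. w = [] \<and> j = 0}"
    by blast
  then show ?thesis by (cases "j = 0") simp_all
qed

text \<open>Only a one tolerates a zero immediately behind it.\<close>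

lemma inner_insertions_Cons:
  assumes "drops_at_most_one (x # v)"
  shows "inner_insertions (x # v) j =
    (#) (Suc x) ` (if x = 0 then insertions v j else inner_insertions v j)" (is "_ = _ ` ?S")
proof (intro equalityI subsetI)
  fix w assume w: "w \<in> inner_insertions (x # v) j"
  then obtain w' where w': "w = Suc x # w'"
    by (cases w rule: strip.cases) (auto simp: inner_insertions_def insertions_def)
  with w have "w' \<in> ?S"
    by (auto simp: inner_insertions_def insertions_def successively_Cons)
  with w' show "w \<in> (#) (Suc x) ` ?S" by simp
next
  fix w assume "w \<in> (#) (Suc x) ` ?S"
  then obtain w' where w: "w = Suc x # w'" and w': "w' \<in> ?S"
    by blast
  have ins: "drops_at_most_one w'" "strip w' = v" "count_list w' 0 = j"
    using w' by (auto simp: inner_insertions_def insertions_def split: if_splits)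
  have "Suc x \<le> hd w' + 1" if "w' \<noteq> []"
  proof (cases "x = 0")
    case False
    with w' have "hd w' \<noteq> 0"
      using that by (auto simp: inner_insertions_def)
    then have "hd w' = Suc (hd v) \<and> v \<noteq> []"
      using that ins(2) by (cases w' rule: strip.cases) auto
    with assms show ?thesis by (auto simp: successively_Cons)
  qed simp
  with ins show "w \<in> inner_insertions (x # v) j"
    by (auto simp: w inner_insertions_def insertions_def successively_Cons)
qed

text \<open>Pascal's rule, according to whether the front gap is used.\<close>

lemma card_insertions_from_inner:
  assumes "\<And>j. card (inner_insertions v j) = (j + m - 1) choose j"
  shows "card (insertions v j) = (j + m) choose j"
proof (induction j)
  case 0
  show ?case
    using assms[of 0] by (simp add: insertions_0)
next
  case (Suc j)
  have "card (insertions v (Suc j)) =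
      card ((#) 0 ` insertions v j) + card (inner_insertions v (Suc j))"
    unfolding insertions_Suc
  proof (rule card_Un_disjoint)
    show "finite ((#) 0 ` insertions v j)"
      by (simp add: finite_insertions)
    show "finite (inner_insertions v (Suc j))"
      using finite_insertions by (simp add: inner_insertions_def)
    show "(#) 0 ` insertions v j \<inter> inner_insertions v (Suc j) = {}"
      by (auto simp: inner_insertions_def)
  qed
  also have "\<dots> = ((j + m) choose j) + ((Suc j + m - 1) choose Suc j)"
    by (simp only: Suc.IH[symmetric] assms card_image inj_on_def list.inject)
       (simp add: card_image)
  also have "\<dots> = (Suc j + m) choose Suc j"
    by simp
  finally show ?case .
qed

text \<open>There are as many inner gaps as zeros in \<open>v\<close>. The truncated subtraction gives the right value
  also if there is none: \<open>(j - 1) choose j\<close> is \<open>1\<close> for \<open>j = 0\<close> and \<open>0\<close> otherwise.\<close>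

lemma card_inner_insertions:
  "drops_at_most_one v \<Longrightarrow> card (inner_insertions v j) = (j + count_list v 0 - 1) choose j"
proof (induction v arbitrary: j)
  case Nil
  show ?case by (auto simp: inner_insertions_Nil)
next
  case (Cons x v)
  have IH: "card (inner_insertions v i) = (i + count_list v 0 - 1) choose i" for i
    using Cons by (auto simp: successively_Cons)
  show ?case
    using IH card_insertions_from_inner[OF IH]
    by (simp add: inner_insertions_Cons[OF Cons.prems] card_image)
qed

lemma card_insertions:
  assumes "drops_at_most_one v"
  shows "card (insertions v j) = (j + count_list v 0) choose j"
  using card_insertions_from_inner card_inner_insertions[OF assms] .

section \<open>The fibres of stripping\<close>

text \<open>With one zero prepended, the first one has a zero in front of it. It has none behind it only
  if all the inserted zeros are in front, because \<open>v\<close> starts with a zero, so that the first one is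
  the first positive letter.\<close>

lemma flanked_Cons_insertion_iff:
  assumes "flanked (0 # v)" "w \<in> insertions (0 # v) j"
  shows "flanked (0 # w) \<longleftrightarrow> w \<noteq> replicate j 0 @ map Suc (0 # v)"
proof
  assume fl: "flanked (0 # w)"
  show "w \<noteq> replicate j 0 @ map Suc (0 # v)"
  proof
    assume "w = replicate j 0 @ map Suc (0 # v)"
    then have "0 # w = (0 # replicate j 0) @ Suc 0 # map Suc v"
      by simp
    from flankedD(2)[OF fl this] show False by auto
  qed
next
  assume ne: "w \<noteq> replicate j 0 @ map Suc (0 # v)"
  have w: "strip w = 0 # v" "count_list w 0 = j"
    using assms(2) by (auto simp: insertions_def)
  have "0 \<in> set us \<and> 0 \<in> set vs" if dec: "0 # w = us @ 1 # vs" and fresh: "1 \<notin> set us" for us vs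
  proof -
    obtain us' where us: "us = 0 # us'"
      using dec by (cases us) auto
    with dec have w_eq: "w = us' @ 1 # vs" by simp
    then have "strip us' @ 0 # strip vs = 0 # v"
      using w(1) by simp
    moreover have "0 \<notin> set (strip us')"
      using fresh us by simp
    ultimately have "strip us' = [] \<and> strip vs = v"
      by (cases "strip us'") (auto simp del: in_set_strip)
    then have s: "strip us' = []" "strip vs = v"
      by auto
    have "0 \<in> set vs"
    proof (rule ccontr)
      assume no0: "0 \<notin> set vs"
      then have "vs = map Suc v"
        using map_Suc_strip s(2) by metis
      moreover have "count_list us' 0 = j"
        using w(2) no0 by (simp add: w_eq)
      then have "us' = replicate j 0"
        using strip_eq_NilD[OF s(1)] by simp
      ultimately show False
        using ne w_eq by simp
    qed
    with us show ?thesis by simp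
  qed
  then show "flanked (0 # w)"
    using assms(1) w(1) unfolding flanked_iff_strip[of "0 # w"] by simp
qed

lemma fibre_eq:
  assumes "0 # v \<in> LL p"
  shows "{w \<in> LL (p + Suc j). strip w = 0 # v \<and> count_list w 0 = Suc j} =
    (#) 0 ` (insertions (0 # v) j - {replicate j 0 @ map Suc (0 # v)})" (is "?F = _ ` ?S")
proof (intro equalityI subsetI)
  have fl: "flanked (0 # v)"
    using assms by (simp add: in_LL_iff)
  fix w
  {
    assume "w \<in> ?F"
    then have w: "flanked w" "drops_at_most_one w" "strip w = 0 # v" "count_list w 0 = Suc j"
      by (auto simp: in_LL_iff)
    then have "w \<noteq> []" by auto
    with w(1) obtain w' where w': "w = 0 # w'"
      by (rule flanked_start)
    with w have "w' \<in> insertions (0 # v) j"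
      by (auto simp: insertions_def successively_Cons)
    with flanked_Cons_insertion_iff[OF fl this] w(1) w' show "w \<in> (#) 0 ` ?S"
      by simp
  next
    assume "w \<in> (#) 0 ` ?S"
    then obtain w' where w': "w = 0 # w'" "w' \<in> insertions (0 # v) j"
        "w' \<noteq> replicate j 0 @ map Suc (0 # v)"
      by blast
    have "flanked w"
      using flanked_Cons_insertion_iff[OF fl w'(2)] w'(1,3) by simp
    moreover have "drops_at_most_one w" "strip w = 0 # v" "count_list w 0 = Suc j"
      using w'(1,2) by (auto simp: insertions_def successively_Cons)
    moreover have "length w = p + Suc j"
      using length_strip[of w] calculation assms by (simp add: in_LL_iff)
    ultimately show "w \<in> ?F"
      by (simp add: in_LL_iff)
  }
qed

text \<open>Hence excluding this word lowers the number of insertions by exactly one.\<close>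

lemma front_insertion_in_insertions:
  assumes "drops_at_most_one v"
  shows "replicate j 0 @ map Suc v \<in> insertions v j"
proof -
  have "drops_at_most_one (map Suc v)"
    using assms by (simp add: successively_map)
  then have "drops_at_most_one (replicate j 0 @ map Suc v)"
    by (induction j) (auto simp: successively_Cons)
  moreover have "count_list (map Suc v) 0 = 0"
    by (auto simp: count_list_0_iff)
  moreover have "count_list (replicate j 0) (0::nat) = j"
    by (induction j) auto
  ultimately show ?thesis
    by (simp add: insertions_def)
qed

lemma card_fibre:
  assumes "v \<in> LL p" "v \<noteq> []" "i > 0"
  shows "int (card {w \<in> LL (p + i). strip w = v \<and> count_list w 0 = i}) =
    int ((i + count_list v 0 - 1) choose count_list v 0) - 1"
proof -
  obtain j where i: "i = Suc j"
    using assms(3) by (cases i) auto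
  obtain v' where v: "v = 0 # v'"
    using assms(1,2) flanked_start by (auto simp: in_LL_iff)
  have drops: "drops_at_most_one v"
    using assms(1) by (simp add: in_LL_iff)
  have mem: "replicate j 0 @ map Suc v \<in> insertions v j"
    by (rule front_insertion_in_insertions[OF drops])
  have "card {w \<in> LL (p + i). strip w = v \<and> count_list w 0 = i} =
      card (insertions v j - {replicate j 0 @ map Suc v})"
    using fibre_eq[of v' p j] assms(1) by (simp add: v i card_image)
  also have "int \<dots> = int (card (insertions v j)) - 1"
  proof -
    have "0 < card (insertions v j)"
      using mem finite_insertions by (auto simp: card_gt_0_iff)
    with mem show ?thesis
      by (simp add: card_Diff_singleton of_nat_diff)
  qed
  also have "card (insertions v j) = (j + count_list v 0) choose count_list v 0"
    using card_insertions[OF drops] binomial_symmetric[of j "j + count_list v 0"] by simp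
  finally show ?thesis
    by (simp add: i)
qed

section \<open>Words with a given number of ones\<close>

lemma strip_in_LL: "w \<in> LL n \<Longrightarrow> strip w \<in> LL (n - count_list w 0)"
  using length_strip[of w] drops_at_most_one_strip iffD1[OF flanked_iff_strip, THEN conjunct1]
  by (simp add: in_LL_iff)

lemma card_ones_zeros:
  assumes "0 < m" "0 < i" "i \<le> n"
  shows "int (card {w \<in> LL n. count_list w 1 = m \<and> count_list w 0 = i}) =
    (int ((i + m - 1) choose m) - 1) * int (a (n - i) m)"
proof -
  let ?S = "{w \<in> LL n. count_list w 1 = m \<and> count_list w 0 = i}"
  let ?T = "{v \<in> LL (n - i). count_list v 0 = m}"
  have by_strip: "card ?S = (\<Sum>v\<in>?T. card {w \<in> ?S. strip w = v})"
    unfolding card_eq_sum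
  proof (rule sum.group[symmetric])
    show "strip ` ?S \<subseteq> ?T"
      using strip_in_LL by (auto simp: count_strip_0)
  qed (simp_all add: finite_LL)
  have "int (card ?S) = (\<Sum>v\<in>?T. int ((i + m - 1) choose m) - 1)"
    unfolding by_strip of_nat_sum
  proof (rule sum.cong[OF refl])
    fix v assume v: "v \<in> ?T"
    then have "{w \<in> ?S. strip w = v} =
        {w \<in> LL (n - i + i). strip w = v \<and> count_list w 0 = i}"
      using assms(3) count_strip_0 by auto
    moreover have "v \<noteq> []"
      using v assms(1) by auto
    ultimately show "int (card {w \<in> ?S. strip w = v}) = int ((i + m - 1) choose m) - 1"
      using card_fibre[of v "n - i" i] v assms(2) by simp
  qed
  also have "\<dots> = (int ((i + m - 1) choose m) - 1) * int (a (n - i) m)"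
    unfolding a_def sum_constant by (rule mult.commute)
  finally show ?thesis .
qed

text \<open>The summation may start at \<open>2\<close>, since the term for a single zero vanishes.\<close>

lemma b_eq_sum:
  assumes "0 < m" "m < n"
  shows "int (b n m) = (\<Sum>i = 2..n - m. (int ((i + m - 1) choose m) - 1) * int (a (n - i) m))"
    (is "_ = (\<Sum>i = 2.._. ?t i)")
proof -
  let ?S = "{w \<in> LL n. count_list w 1 = m}"
  have zeros: "count_list w 0 \<in> {1..n - m}" if "w \<in> ?S" for w
  proof -
    have w: "length w = n" "flanked w" "count_list w 1 = m"
      using that by (auto simp: in_LL_iff)
    have "w \<noteq> []"
      using w(1) assms by auto
    with w(2) obtain w' where "w = 0 # w'"
      by (rule flanked_start)
    then have "count_list w 0 \<ge> 1" by simp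
    moreover have "m \<le> length (strip w)"
      using count_le_length[of "strip w" 0] w(3) by (simp only: count_strip_0)
    ultimately show ?thesis
      using length_strip[of w] w(1) by simp
  qed
  have by_zeros: "b n m = (\<Sum>i = 1..n - m. card {w \<in> ?S. count_list w 0 = i})"
    unfolding b_def card_eq_sum
  proof (rule sum.group[symmetric])
    show "(\<lambda>w. count_list w 0) ` ?S \<subseteq> {1..n - m}"
      using zeros by auto
  qed (simp_all add: finite_LL)
  have "int (b n m) = (\<Sum>i = 1..n - m. ?t i)"
    unfolding by_zeros of_nat_sum
  proof (rule sum.cong[OF refl])
    fix i assume "i \<in> {1..n - m}"
    then have "int (card {w \<in> LL n. count_list w 1 = m \<and> count_list w 0 = i}) = ?t i"
      by (intro card_ones_zeros[OF assms(1)]) auto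
    moreover have "{w \<in> ?S. count_list w 0 = i} =
        {w \<in> LL n. count_list w 1 = m \<and> count_list w 0 = i}"
      by auto
    ultimately show "int (card {w \<in> ?S. count_list w 0 = i}) = ?t i"
      by simp
  qed
  also have "\<dots> = ?t 1 + (\<Sum>i = 2..n - m. ?t i)"
    using assms by (simp add: sum.atLeast_Suc_atMost numeral_2_eq_2)
  finally show ?thesis by simp
qed

lemma b_no_ones: "b n 0 = 1"
proof -
  have "{w \<in> LL n. count_list w 1 = 0} = {replicate n 0}"
  proof (intro equalityI subsetI)
    fix w assume "w \<in> {w \<in> LL n. count_list w 1 = 0}"
    then have w: "length w = n" "flanked w" "1 \<notin> set w"
      by (auto simp: in_LL_iff count_list_0_iff)
    have "x = 0" if "x \<in> set w" for x
      using flanked_letters_downward_closed[OF w(2) that, of 1] w(3) by (cases x) auto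
    with w(1) show "w \<in> {replicate n 0}"
      by (simp add: replicate_eqI)
  next
    fix w assume "w \<in> {replicate n (0::nat)}"
    then have w: "w = replicate n 0" by simp
    have "set w \<subseteq> {0}"
      by (auto simp: w)
    then have "flanked w"
      by (auto simp: flanked_def)
    moreover have "drops_at_most_one w"
      by (auto simp: w successively_conv_nth)
    moreover have "count_list w 1 = 0"
      by (auto simp: w count_list_0_iff)
    ultimately show "w \<in> {w \<in> LL n. count_list w 1 = 0}"
      by (simp add: in_LL_iff w)
  qed
  then show ?thesis
    by (simp add: b_def)
qed

theorem proposition2p3:
  shows "(\<forall>n m :: nat. 3 \<le> n \<and> 1 \<le> m \<and> m \<le> n - 2 \<longrightarrow>
            int (b n m) = (\<Sum>i = 2..n - m. (int ((i + m - 1) choose m) - 1) * int (a (n - i) m)))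
       \<and> (\<forall>n :: nat. 1 \<le> n \<longrightarrow> b n 0 = 1)
       \<and> (\<forall>n :: nat. 2 \<le> n \<longrightarrow> b n (n - 1) = 0)"
proof (intro conjI allI impI)
  fix n m :: nat
  assume "3 \<le> n \<and> 1 \<le> m \<and> m \<le> n - 2"
  then show "int (b n m) =
      (\<Sum>i = 2..n - m. (int ((i + m - 1) choose m) - 1) * int (a (n - i) m))"
    by (intro b_eq_sum) auto
next
  fix n :: nat
  show "b n 0 = 1" by (rule b_no_ones)
next
  fix n :: nat
  assume "2 \<le> n"
  then show "b n (n - 1) = 0"
    using b_eq_sum[of "n - 1" n] by simp
qed

end
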